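(* Let $(X,Y,\langle\cdot,\cdot\rangle)$ be a dual system and let $n,m\in\{1,2,\dots\}\cup\{\infty\}$. An operator $T:X\rightrightarrows Y$ is $(n+m)$-monotone if and only if one (equivalently, each) of the following conditions holds: (i) $\varphi_T^{\langle n\rangle}\le P_T^{\langle m\rangle}$; (ii) $\varphi_T^{\langle n\rangle}\le\operatorname{conv}P_T^{\langle m\rangle}$; (iii) $\varphi_T^{\langle n\rangle}\le\psi_T^{\langle m\rangle}$. In this case, for every $k\in\{1,2,\dots\}\cup\{\infty\}$ with $1\le k\le n+m-1$, $$\operatorname{Graph}T\subset[\varphi_T^{\langle k\rangle}=c]\cap[P_T^{\langle k\rangle}=c]\cap[\operatorname{conv}P_T^{\langle k\rangle}=c]\cap[\psi_T^{\langle k\rangle}=c],$$ and, whenever $\operatorname{Graph}T\ne\emptyset$, the functions $\varphi_T^{\langle k\rangle}$, $\psi_T^{\langle k\rangle}$, $\operatorname{conv}P_T^{\langle k\rangle}$, $P_T^{\langle k\rangle}$ are proper for all such $k$.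
   Context: All vector spaces are real. A dual system $(X,Y,\langle\cdot,\cdot\rangle)$ consists of vector spaces $X,Y$ and a bilinear map $c=\langle\cdot,\cdot\rangle:X\times Y\to\mathbb{R}$. Put $Z=X\times Y$, $c(x,y)=\langle x,y\rangle$, and $z\cdot w=\langle x,v\rangle+\langle u,y\rangle$ for $z=(x,y)$, $w=(u,v)\in Z$. For $f:Z\to\overline{\mathbb{R}}$, $f^{\square}(z)=\sup_{z'\in Z}\{z\cdot z'-f(z')\}$, and $\operatorname{conv}f$ is the convex hull of $f$, i.e. $(\operatorname{conv}f)(z)=\inf\{t\in\mathbb R\mid(z,t)\in\operatorname{conv}(\operatorname{Epi}f)\}$ with $\operatorname{Epi}f=\{(z,t)\in Z\times\mathbb R\mid f(z)\le t\}$. A function is proper if it is not identically $+\infty$ and never takes the value $-\infty$. $[f=g]=\{z\mid f(z)=g(z)\}$; $f\le g$ means the inequality holds at every point. Conventions: $\sup\emptyset=-\infty$, $\inf\emptyset=+\infty$, and $\infty+m=\infty=\infty-1$. $T:X\rightrightarrows Y$ is a multifunction with $\operatorname{Graph}T=\{(x,y)\mid y\in T(x)\}$ and $T^{-1}(y)=\{x\mid y\in T(x)\}$. For finite $n$, $T$ is $n$-monotone if $\sum_{i=1}^n\langle x_i-x_{i+1},y_i\rangle\ge0$ for all $(x_1,y_1),\dots,(x_n,y_n)\in\operatorname{Graph}T$, with $x_{n+1}=x_1$; $T$ is $\infty$-monotone (cyclically monotone) if it is $k$-monotone for every integer $k\ge2$. For finite $n\ge1$, $\varphi_T^{\langle n\rangle}(x,y)=\sup\{\langle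 x-x_1,y_1\rangle+\sum_{i=2}^n\langle x_{i-1}-x_i,y_i\rangle+\langle x_n,y\rangle\mid (x_i,y_i)\in\operatorname{Graph}T,\ 1\le i\le n\}$, and $\varphi_T^{\langle\infty\rangle}=\sup_{n\ge1}\varphi_T^{\langle n\rangle}$. For all $n\in\{1,2,\dots\}\cup\{\infty\}$, $\psi_T^{\langle n\rangle}=(\varphi_T^{\langle n\rangle})^{\square}$. The functions $P_T^{\langle n\rangle}:Z\to\overline{\mathbb R}$ are: $P_T^{\langle1\rangle}=c_T$, where $c_T=c$ on $\operatorname{Graph}T$ and $+\infty$ elsewhere; $P_T^{\langle2\rangle}(x,y)=\inf\{\langle x_1,y\rangle+\langle x-x_1,y_2\rangle\mid x_1\in T^{-1}(y),\,y_2\in T(x)\}$; for $3\le n<\infty$, $P_T^{\langle n\rangle}(x,y)=\inf\{\langle x_1,y\rangle+\sum_{i=2}^{n-1}\langle x_i-x_{i-1},y_i\rangle+\langle x-x_{n-1},y_n\rangle\mid x_1\in T^{-1}(y),\,y_n\in T(x),\,(x_i,y_i)\in\operatorname{Graph}T\ (2\le i\le n-1)\}$; and $P_T^{\langle\infty\rangle}=\inf_{n\ge1}P_T^{\langle n\rangle}$. *)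

theory Defs
  imports "HOL-Analysis.Analysis"
begin

text \<open>The spaces \<open>X\<close> and \<open>Y\<close> of a dual system are the types \<open>'x\<close> and \<open>'y\<close> of class
  \<^class>\<open>real_vector\<close>, and \<open>Z\<close> is \<open>'x \<times> 'y\<close>. The pairing \<open>c\<close> is an arbitrary bilinear map; it is
  assumed neither nondegenerate nor continuous. Orders \<open>n \<in> {1, 2, \<dots>} \<union> {\<infinity>}\<close> are elements of
  \<^typ>\<open>enat\<close> with \<open>1 \<le> n\<close>; the values of the functions below at \<open>0\<close> have no meaning.\<close>

definition graph_of :: "('x \<Rightarrow> 'y set) \<Rightarrow> ('x \<times> 'y) set" where
  "graph_of T = {(x, y). y \<in> T x}"

definition inv_op :: "('x \<Rightarrow> 'y set) \<Rightarrow> 'y \<Rightarrow> 'x set" where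
  "inv_op T y = {x. y \<in> T x}"

definition coupling :: "('x \<Rightarrow> 'y \<Rightarrow> real) \<Rightarrow> 'x \<times> 'y \<Rightarrow> ereal" where
  "coupling c = (\<lambda>(x, y). ereal (c x y))"

definition zdot :: "('x \<Rightarrow> 'y \<Rightarrow> real) \<Rightarrow> 'x \<times> 'y \<Rightarrow> 'x \<times> 'y \<Rightarrow> real" where
  "zdot c z w = c (fst z) (snd w) + c (fst w) (snd z)"

definition conjugate :: "('x \<Rightarrow> 'y \<Rightarrow> real) \<Rightarrow> ('x \<times> 'y \<Rightarrow> ereal) \<Rightarrow> 'x \<times> 'y \<Rightarrow> ereal" where
  "conjugate c f z = (SUP z'. ereal (zdot c z z') - f z')"

definition epi :: "('z \<Rightarrow> ereal) \<Rightarrow> ('z \<times> real) set" where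
  "epi f = {(z, t). f z \<le> ereal t}"

definition conv_fun :: "('z::real_vector \<Rightarrow> ereal) \<Rightarrow> 'z \<Rightarrow> ereal" where
  "conv_fun f z = Inf {ereal t |t. (z, t) \<in> convex hull (epi f)}"

definition proper_fun :: "('z \<Rightarrow> ereal) \<Rightarrow> bool" where
  "proper_fun f \<longleftrightarrow> (\<exists>z. f z \<noteq> \<infinity>) \<and> (\<forall>z. f z \<noteq> -\<infinity>)"

definition eq_set :: "('z \<Rightarrow> ereal) \<Rightarrow> ('z \<Rightarrow> ereal) \<Rightarrow> 'z set" where
  "eq_set f g = {z. f z = g z}"

text \<open>Finite families \<open>(x\<^sub>i, y\<^sub>i)\<close> are given by functions on \<^typ>\<open>nat\<close>, of which only the
  values at the indices occurring in the formulas matter.\<close>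

definition monotone_fin ::
  "('x::real_vector \<Rightarrow> 'y::real_vector \<Rightarrow> real) \<Rightarrow> ('x \<Rightarrow> 'y set) \<Rightarrow> nat \<Rightarrow> bool" where
  "monotone_fin c T n \<longleftrightarrow>
     (\<forall>x y. (\<forall>i\<in>{1..n}. (x i, y i) \<in> graph_of T) \<longrightarrow>
        (\<Sum>i=1..n. c (x i - x (if i = n then 1 else i + 1)) (y i)) \<ge> 0)"

definition monotone_op ::
  "('x::real_vector \<Rightarrow> 'y::real_vector \<Rightarrow> real) \<Rightarrow> ('x \<Rightarrow> 'y set) \<Rightarrow> enat \<Rightarrow> bool" where
  "monotone_op c T n = (case n of enat k \<Rightarrow> monotone_fin c T k | \<infinity> \<Rightarrow> (\<forall>k\<ge>2. monotone_fin c T k))"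

definition phi_fin ::
  "('x::real_vector \<Rightarrow> 'y::real_vector \<Rightarrow> real) \<Rightarrow> ('x \<Rightarrow> 'y set) \<Rightarrow> nat \<Rightarrow> 'x \<times> 'y \<Rightarrow> ereal" where
  "phi_fin c T n = (\<lambda>(x, y).
     Sup {ereal (c (x - xs 1) (ys 1) + (\<Sum>i=2..n. c (xs (i - 1) - xs i) (ys i)) + c (xs n) y) |xs ys.
            \<forall>i\<in>{1..n}. (xs i, ys i) \<in> graph_of T})"

definition phi ::
  "('x::real_vector \<Rightarrow> 'y::real_vector \<Rightarrow> real) \<Rightarrow> ('x \<Rightarrow> 'y set) \<Rightarrow> enat \<Rightarrow> 'x \<times> 'y \<Rightarrow> ereal" where
  "phi c T n z = (case n of enat k \<Rightarrow> phi_fin c T k z | \<infinity> \<Rightarrow> (SUP k\<in>{1..}. phi_fin c T k z))"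

definition psi ::
  "('x::real_vector \<Rightarrow> 'y::real_vector \<Rightarrow> real) \<Rightarrow> ('x \<Rightarrow> 'y set) \<Rightarrow> enat \<Rightarrow> 'x \<times> 'y \<Rightarrow> ereal" where
  "psi c T n = conjugate c (phi c T n)"

definition P_fin ::
  "('x::real_vector \<Rightarrow> 'y::real_vector \<Rightarrow> real) \<Rightarrow> ('x \<Rightarrow> 'y set) \<Rightarrow> nat \<Rightarrow> 'x \<times> 'y \<Rightarrow> ereal" where
  "P_fin c T n = (\<lambda>(x, y).
     if n = 1 then (if (x, y) \<in> graph_of T then coupling c (x, y) else \<infinity>)
     else if n = 2 then
       Inf {ereal (c x1 y + c (x - x1) y2) |x1 y2. x1 \<in> inv_op T y \<and> y2 \<in> T x}
     else
       Inf {ereal (c (xs 1) y + (\<Sum>i=2..n-1. c (xs i - xs (i - 1)) (ys i)) + c (x - xs (n - 1)) (ys n)) |xs ys.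
              xs 1 \<in> inv_op T y \<and> ys n \<in> T x \<and> (\<forall>i\<in>{2..n-1}. (xs i, ys i) \<in> graph_of T)})"

definition P_fun ::
  "('x::real_vector \<Rightarrow> 'y::real_vector \<Rightarrow> real) \<Rightarrow> ('x \<Rightarrow> 'y set) \<Rightarrow> enat \<Rightarrow> 'x \<times> 'y \<Rightarrow> ereal" where
  "P_fun c T n z = (case n of enat k \<Rightarrow> P_fin c T k z | \<infinity> \<Rightarrow> (INF k\<in>{1..}. P_fin c T k z))"

end

theory Submission
  imports Defs
begin

text \<open>
  All four functions are governed by finite chains \<open>s = ((x\<^sub>1, y\<^sub>1), \<dots>, (x\<^sub>k, y\<^sub>k))\<close> in \<open>Graph T\<close>.
  Give such a chain the cost \<open>\<langle>x\<^sub>1, y\<^sub>1\<rangle> + \<Sum>\<^sub>i \<langle>x\<^sub>i - x\<^sub>i\<^sub>-\<^sub>1, y\<^sub>i\<rangle>\<close> and the tip \<open>(x\<^sub>k, y\<^sub>1)\<close>. Then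
  \<open>P\<^sub>n(z)\<close> is the least cost of a chain with tip \<open>z\<close>, while \<open>\<phi>\<^sub>n(z)\<close> is the supremum of
  \<open>z \<cdot> tip s - cost s\<close>. Hence \<open>\<phi>\<^sub>n\<close> is the conjugate of \<open>P\<^sub>n\<close>, and \<open>\<psi>\<^sub>n\<close> is its biconjugate, so that
  \<open>\<psi>\<^sub>n \<le> conv P\<^sub>n \<le> P\<^sub>n\<close> in general.

  Read backwards, the cyclic sum that defines \<open>N\<close>-monotonicity is the cost of a chain of length \<open>N\<close>
  minus the value of the pairing at its tip. Cutting a chain of length \<open>a + b\<close> into chains \<open>p\<close> and \<open>q\<close>
  of lengths \<open>a\<close> and \<open>b\<close> therefore shows that \<open>T\<close> is \<open>(n + m)\<close>-monotone iff
  \<open>tip p \<cdot> tip q \<le> cost p + cost q\<close> for all chains \<open>p\<close> of order \<open>n\<close> and \<open>q\<close> of order \<open>m\<close>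
  (\<open>monotone_op_add_iff\<close>). This is precisely \<open>\<phi>\<^sub>n \<le> P\<^sub>m\<close>. The condition is symmetric in \<open>n\<close> and \<open>m\<close>,
  so it also says \<open>\<phi>\<^sub>m \<le> P\<^sub>n\<close>; conjugation reverses this to \<open>\<phi>\<^sub>n \<le> \<psi>\<^sub>m\<close>, and the three
  conditions coincide.

  If \<open>T\<close> is \<open>(k + 1)\<close>-monotone, these inequalities for the orders \<open>(k, 1)\<close> and \<open>(1, k)\<close> give
  \<open>\<phi>\<^sub>k \<le> P\<^sub>1\<close> and \<open>\<phi>\<^sub>1 \<le> \<psi>\<^sub>k \<le> conv P\<^sub>k \<le> P\<^sub>k\<close>. On \<open>Graph T\<close> constant chains give
  \<open>P\<^sub>k \<le> c\<close> and \<open>c \<le> \<phi>\<^sub>k\<close>, whence all the functions equal \<open>c\<close> there. If \<open>Graph T\<close> is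
  nonempty, \<open>\<phi>\<^sub>k\<close> and \<open>\<phi>\<^sub>1\<close> are suprema of nonempty families of finite affine functions, so they
  and all functions above them avoid \<open>-\<infinity>\<close>; a point of the graph supplies a finite value.
\<close>

section \<open>Chains in the graph\<close>

definition chain :: "('x \<Rightarrow> 'y set) \<Rightarrow> nat \<Rightarrow> (nat \<Rightarrow> 'x \<times> 'y) \<Rightarrow> bool" where
  "chain T k s \<longleftrightarrow> (\<forall>i\<in>{1..k}. s i \<in> graph_of T)"

definition cost ::
  "('x::real_vector \<Rightarrow> 'y::real_vector \<Rightarrow> real) \<Rightarrow> nat \<Rightarrow> (nat \<Rightarrow> 'x \<times> 'y) \<Rightarrow> real" where
  "cost c k s = c (fst (s 1)) (snd (s 1)) + (\<Sum>i=2..k. c (fst (s i) - fst (s (i - 1))) (snd (s i)))"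

definition tip :: "nat \<Rightarrow> (nat \<Rightarrow> 'x \<times> 'y) \<Rightarrow> 'x \<times> 'y" where
  "tip k s = (fst (s k), snd (s 1))"

text \<open>The lengths of the chains that contribute at order \<open>N\<close>: the infinite order collects all
  finite ones, so that both cases can be treated as one.\<close>

definition lengths :: "enat \<Rightarrow> nat set" where
  "lengths N = (case N of enat k \<Rightarrow> {k} | \<infinity> \<Rightarrow> {1..})"

lemma lengths_pos:
  assumes "1 \<le> N" and "k \<in> lengths N"
  shows "1 \<le> k"
  using assms by (cases N) (auto simp: lengths_def one_enat_def)

lemma lengths_nonempty: "\<exists>k. k \<in> lengths N"
  by (cases N) (auto simp: lengths_def)

lemma ex_chain_families:
  "(\<exists>xs ys. Q xs ys) \<longleftrightarrow> (\<exists>s :: nat \<Rightarrow> 'x \<times> 'y. Q (fst \<circ> s) (snd \<circ> s))"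
proof
  assume "\<exists>xs ys. Q xs ys"
  then obtain xs ys where "Q xs ys" by blast
  then have "Q (fst \<circ> (\<lambda>i. (xs i, ys i))) (snd \<circ> (\<lambda>i. (xs i, ys i)))"
    by (simp add: comp_def)
  then show "\<exists>s. Q (fst \<circ> s) (snd \<circ> s)" by blast
qed blast

lemma chainD:
  assumes "chain T k s" and "1 \<le> i" and "i \<le> k"
  shows "s i \<in> graph_of T"
  using assms by (simp add: chain_def)

lemma chain_const:
  assumes "z \<in> graph_of T"
  shows "chain T k (\<lambda>_. z)"
  using assms by (simp add: chain_def)

lemma tip_const [simp]: "tip k (\<lambda>_. z) = z"
  by (simp add: tip_def)

section \<open>Monotonicity and concatenation of chains\<close>

text \<open>Reversing the cycle turns the forward differences \<open>x\<^sub>i - x\<^sub>i\<^sub>+\<^sub>1\<close> into the backward differences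
  of the cost; the difference that closes the cycle is \<open>x\<^sub>1 - x\<^sub>N\<close>, whose second half is the pairing at
  the tip.\<close>

lemma cyclic_sum_reverse:
  assumes "bilinear c" and "1 \<le> N"
  shows "(\<Sum>i=1..N. c (fst (s (N + 1 - i)) - fst (s (N + 1 - (if i = N then 1 else i + 1)))) (snd (s (N + 1 - i))))
         = cost c N s - c (fst (s N)) (snd (s 1))"
proof -
  let ?g = "\<lambda>j. c (fst (s j) - fst (s (if j = 1 then N else j - 1))) (snd (s j))"
  have "(\<Sum>i=1..N. c (fst (s (N + 1 - i)) - fst (s (N + 1 - (if i = N then 1 else i + 1)))) (snd (s (N + 1 - i))))
      = (\<Sum>j=1..N. ?g j)"
    by (rule sum.reindex_bij_witness[where i = "\<lambda>j. N + 1 - j" and j = "\<lambda>i. N + 1 - i"]) auto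
  also have "\<dots> = ?g 1 + (\<Sum>j=2..N. ?g j)"
    using assms(2) by (simp add: sum.atLeast_Suc_atMost numeral_2_eq_2)
  also have "(\<Sum>j=2..N. ?g j) = (\<Sum>j=2..N. c (fst (s j) - fst (s (j - 1))) (snd (s j)))"
    by (intro sum.cong) auto
  finally show ?thesis
    using assms(1) by (simp add: cost_def bilinear_lsub)
qed

lemma monotone_fin_iff:
  assumes "bilinear c" and "1 \<le> N"
  shows "monotone_fin c T N \<longleftrightarrow> (\<forall>s. chain T N s \<longrightarrow> c (fst (s N)) (snd (s 1)) \<le> cost c N s)"
proof
  assume mono: "monotone_fin c T N"
  show "\<forall>s. chain T N s \<longrightarrow> c (fst (s N)) (snd (s 1)) \<le> cost c N s"
  proof (intro allI impI)
    fix s assume s: "chain T N s"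
    let ?x = "\<lambda>i. fst (s (N + 1 - i))" and ?y = "\<lambda>i. snd (s (N + 1 - i))"
    have xy: "\<forall>i\<in>{1..N}. (?x i, ?y i) \<in> graph_of T"
      using s by (auto intro!: chainD[OF s])
    have "0 \<le> (\<Sum>i=1..N. c (?x i - ?x (if i = N then 1 else i + 1)) (?y i))"
      by (rule mono[unfolded monotone_fin_def, THEN spec[of _ ?x], THEN spec[of _ ?y], THEN mp, OF xy])
    then show "c (fst (s N)) (snd (s 1)) \<le> cost c N s"
      unfolding cyclic_sum_reverse[OF assms] by simp
  qed
next
  assume le: "\<forall>s. chain T N s \<longrightarrow> c (fst (s N)) (snd (s 1)) \<le> cost c N s"
  show "monotone_fin c T N"
    unfolding monotone_fin_def
  proof (intro allI impI)
    fix x y assume xy: "\<forall>i\<in>{1..N}. (x i, y i) \<in> graph_of T"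
    let ?s = "\<lambda>i. (x (N + 1 - i), y (N + 1 - i))"
    have "chain T N ?s"
      unfolding chain_def
    proof
      fix i assume "i \<in> {1..N}"
      then have "N + 1 - i \<in> {1..N}" by auto
      with xy show "?s i \<in> graph_of T" by blast
    qed
    with le have "0 \<le> cost c N ?s - c (fst (?s N)) (snd (?s 1))"
      by fastforce
    also have "\<dots> = (\<Sum>i=1..N. c (x i - x (if i = N then 1 else i + 1)) (y i))"
      unfolding cyclic_sum_reverse[OF assms, of ?s, symmetric] by (intro sum.cong) auto
    finally show "0 \<le> (\<Sum>i=1..N. c (x i - x (if i = N then 1 else i + 1)) (y i))" .
  qed
qed

text \<open>At the junction the whole chain has the summand \<open>\<langle>x\<^sub>a\<^sub>+\<^sub>1 - x\<^sub>a, y\<^sub>a\<^sub>+\<^sub>1\<rangle>\<close>, where the second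
  part on its own starts with \<open>\<langle>x\<^sub>a\<^sub>+\<^sub>1, y\<^sub>a\<^sub>+\<^sub>1\<rangle>\<close>.\<close>

lemma cost_split:
  assumes "bilinear c" and "1 \<le> a" and "1 \<le> b"
  shows "cost c (a + b) s = cost c a s + cost c b (\<lambda>i. s (a + i)) - c (fst (s a)) (snd (s (a + 1)))"
proof -
  let ?h = "\<lambda>i. c (fst (s i) - fst (s (i - 1))) (snd (s i))"
  have "sum ?h {2..a + b} = sum ?h {2..a} + sum ?h {a + 1..a + b}"
    using assms(2) by (subst sum.ub_add_nat) auto
  also have "sum ?h {a + 1..a + b} = ?h (a + 1) + sum ?h {a + 2..a + b}"
    using assms(3) by (simp add: sum.atLeast_Suc_atMost)
  also have "sum ?h {a + 2..a + b} = (\<Sum>i=2..b. ?h (a + i))"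
    by (rule sum.reindex_bij_witness[where i = "\<lambda>i. a + i" and j = "\<lambda>i. i - a"]) auto
  also have "(\<Sum>i=2..b. ?h (a + i)) = (\<Sum>i=2..b. c (fst (s (a + i)) - fst (s (a + (i - 1)))) (snd (s (a + i))))"
    by (intro sum.cong) auto
  finally show ?thesis
    using assms(1) by (simp add: cost_def bilinear_lsub)
qed

text \<open>Every chain of length \<open>a + b\<close> splits into two chains, and any two chains can be concatenated.
  The pairing at the junction and the pairing at the tip add up to \<open>tip p \<cdot> tip q\<close>.\<close>

lemma monotone_fin_add_iff:
  assumes "bilinear c" and "1 \<le> a" and "1 \<le> b"
  shows "monotone_fin c T (a + b) \<longleftrightarrow>
    (\<forall>p q. chain T a p \<longrightarrow> chain T b q \<longrightarrow> zdot c (tip a p) (tip b q) \<le> cost c a p + cost c b q)"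
    (is "_ \<longleftrightarrow> ?cross")
proof -
  have "monotone_fin c T (a + b) \<longleftrightarrow>
      (\<forall>s. chain T (a + b) s \<longrightarrow> c (fst (s (a + b))) (snd (s 1)) \<le> cost c (a + b) s)"
    using assms by (intro monotone_fin_iff) auto
  also have "\<dots> \<longleftrightarrow> ?cross"
  proof (intro iffI allI impI)
    fix p q
    assume le: "\<forall>s. chain T (a + b) s \<longrightarrow> c (fst (s (a + b))) (snd (s 1)) \<le> cost c (a + b) s"
      and p: "chain T a p" and q: "chain T b q"
    let ?s = "\<lambda>i. if i \<le> a then p i else q (i - a)"
    have "chain T (a + b) ?s"
      unfolding chain_def
    proof
      fix i assume i: "i \<in> {1..a + b}"
      show "?s i \<in> graph_of T"
      proof (cases "i \<le> a")
        case True
        with i show ?thesis using chainD[OF p, of i] by simp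
      next
        case False
        with i have "1 \<le> i - a" "i - a \<le> b" by auto
        with False show ?thesis using chainD[OF q, of "i - a"] by simp
      qed
    qed
    with le have "c (fst (?s (a + b))) (snd (?s 1)) \<le> cost c (a + b) ?s" by blast
    moreover have "cost c a ?s = cost c a p"
      using assms by (auto simp: cost_def intro!: sum.cong)
    moreover have "cost c b (\<lambda>i. ?s (a + i)) = cost c b q"
      by (auto simp: cost_def intro!: sum.cong)
    ultimately show "zdot c (tip a p) (tip b q) \<le> cost c a p + cost c b q"
      using assms(2,3) by (simp add: cost_split[OF assms] zdot_def tip_def)
  next
    fix s
    assume cross: ?cross and s: "chain T (a + b) s"
    have "chain T a s" "chain T b (\<lambda>i. s (a + i))"
      using s by (auto simp: chain_def)
    with cross have "zdot c (tip a s) (tip b (\<lambda>i. s (a + i))) \<le> cost c a s + cost c b (\<lambda>i. s (a + i))"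
      by blast
    then show "c (fst (s (a + b))) (snd (s 1)) \<le> cost c (a + b) s"
      by (simp add: cost_split[OF assms] zdot_def tip_def)
  qed
  finally show ?thesis .
qed

text \<open>Repeating the last point of a chain changes neither its cost nor its tip.\<close>

lemma monotone_fin_SucD:
  assumes "bilinear c" and "1 \<le> k" and mono: "monotone_fin c T (Suc k)"
  shows "monotone_fin c T k"
  unfolding monotone_fin_iff[OF assms(1,2)]
proof (intro allI impI)
  fix s assume s: "chain T k s"
  with assms(2) have "chain T 1 (\<lambda>_. s k)"
    by (auto simp: chain_def)
  moreover have "monotone_fin c T (k + 1)"
    using mono by simp
  ultimately have "zdot c (tip k s) (tip 1 (\<lambda>_. s k)) \<le> cost c k s + cost c 1 (\<lambda>_. s k)"
    using s monotone_fin_add_iff[OF assms(1,2), of 1] by blast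
  then show "c (fst (s k)) (snd (s 1)) \<le> cost c k s"
    by (simp add: zdot_def tip_def cost_def)
qed

lemma monotone_fin_antimono:
  assumes "bilinear c" and "1 \<le> j" and "j \<le> k" and "monotone_fin c T k"
  shows "monotone_fin c T j"
  using assms(3,4)
proof (induction k rule: dec_induct)
  case (step i)
  then have "monotone_fin c T i"
    using assms(2) by (intro monotone_fin_SucD[OF assms(1), of i T]) simp_all
  then show ?case by (rule step.IH)
qed

lemma monotone_op_antimono:
  assumes "bilinear c" and "2 \<le> j" and "j \<le> k" and "monotone_op c T k"
  shows "monotone_op c T j"
proof (cases j)
  case (enat j')
  then have j': "2 \<le> j'"
    using assms(2) by (simp add: numeral_eq_enat)
  show ?thesis
  proof (cases k)
    case (enat k')
    then have "monotone_fin c T j'"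
      using assms(3,4) j' \<open>j = enat j'\<close>
      by (intro monotone_fin_antimono[OF assms(1), of j' k']) (auto simp: monotone_op_def)
    then show ?thesis
      using \<open>j = enat j'\<close> by (simp add: monotone_op_def)
  next
    case infinity
    then show ?thesis
      using assms(4) j' \<open>j = enat j'\<close> by (simp add: monotone_op_def)
  qed
qed (use assms(3,4) in simp)

lemma monotone_op_add_lengths:
  assumes "bilinear c" and "1 \<le> n" and "1 \<le> m"
  shows "monotone_op c T (n + m) \<longleftrightarrow> (\<forall>a\<in>lengths n. \<forall>b\<in>lengths m. monotone_fin c T (a + b))"
proof (cases "n + m")
  case (enat k)
  then show ?thesis
    by (cases n; cases m) (auto simp: monotone_op_def lengths_def)
next
  case infinity
  have inf: "n = \<infinity> \<or> m = \<infinity>"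
    using infinity by (cases n; cases m) auto
  show ?thesis
  proof (intro iffI ballI)
    fix a b assume "monotone_op c T (n + m)" "a \<in> lengths n" "b \<in> lengths m"
    moreover from this have "1 \<le> a" "1 \<le> b"
      using assms lengths_pos by blast+
    ultimately show "monotone_fin c T (a + b)"
      using infinity by (simp add: monotone_op_def)
  next
    assume fin: "\<forall>a\<in>lengths n. \<forall>b\<in>lengths m. monotone_fin c T (a + b)"
    have "monotone_fin c T k" if k: "2 \<le> k" for k
    proof -
      \<comment> \<open>One of the two lengths is arbitrary, so that their sum can be made at least \<open>k\<close>.\<close>
      obtain a b where ab: "a \<in> lengths n" "b \<in> lengths m" "k \<le> a + b"
      proof (cases "n = \<infinity>")
        case True
        obtain b where "b \<in> lengths m" using lengths_nonempty by blast
        with True k that[of k b] show ?thesis by (auto simp: lengths_def)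
      next
        case False
        obtain a where "a \<in> lengths n" using lengths_nonempty by blast
        with False inf k that[of a k] show ?thesis by (auto simp: lengths_def)
      qed
      then show ?thesis
        using fin k by (intro monotone_fin_antimono[OF assms(1), of k "a + b" T]) auto
    qed
    then show "monotone_op c T (n + m)"
      using infinity by (simp add: monotone_op_def)
  qed
qed

lemma monotone_op_add_iff:
  assumes "bilinear c" and "1 \<le> n" and "1 \<le> m"
  shows "monotone_op c T (n + m) \<longleftrightarrow>
    (\<forall>a\<in>lengths n. \<forall>b\<in>lengths m. \<forall>p q. chain T a p \<longrightarrow> chain T b q \<longrightarrow>
       zdot c (tip a p) (tip b q) \<le> cost c a p + cost c b q)"
  unfolding monotone_op_add_lengths[OF assms]
  by (intro ball_cong refl monotone_fin_add_iff[OF assms(1)] lengths_pos[OF assms(2)]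
      lengths_pos[OF assms(3)])

section \<open>The functions in terms of chains\<close>

lemma phi_fin_eq:
  assumes "bilinear c"
  shows "phi_fin c T k z = Sup {ereal (zdot c z (tip k s) - cost c k s) |s. chain T k s}"
proof -
  obtain x y where z: "z = (x, y)" by (cases z)
  have val: "c (x - fst (s 1)) (snd (s 1)) + (\<Sum>i=2..k. c (fst (s (i - 1)) - fst (s i)) (snd (s i))) + c (fst (s k)) y
      = zdot c z (tip k s) - cost c k s" for s
    using assms by (simp add: z zdot_def tip_def cost_def bilinear_lsub sum_subtractf)
  show ?thesis
    unfolding phi_fin_def z prod.case ex_chain_families comp_apply val[unfolded z] prod.collapse chain_def
    by (rule refl)
qed

text \<open>The three clauses in the definition of \<open>P\<^sub>k\<close> are one formula: the coordinates \<open>y\<^sub>1\<close> and \<open>x\<^sub>k\<close>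
  that it leaves free are the ones that the tip prescribes.\<close>

lemma P_fin_eq:
  assumes "bilinear c" and "1 \<le> k"
  shows "P_fin c T k z = Inf {ereal (cost c k s) |s. chain T k s \<and> tip k s = z}"
proof -
  obtain x y where z: "z = (x, y)" by (cases z)
  consider "k = 1" | "k = 2" | "3 \<le> k" using assms(2) by linarith
  then show ?thesis
  proof cases
    case 1
    have "{ereal (cost c 1 s) |s. chain T 1 s \<and> tip 1 s = z} = (if z \<in> graph_of T then {ereal (c x y)} else {})"
      by (auto simp: z chain_def tip_def cost_def intro!: exI[of _ "\<lambda>_. (x, y)"])
    then show ?thesis
      by (simp add: 1 P_fin_def z coupling_def top_ereal_def)
  next
    case 2
    have set: "{1..2::nat} = {1, 2}" by auto
    have "{ereal (c x1 y + c (x - x1) y2) |x1 y2. x1 \<in> inv_op T y \<and> y2 \<in> T x}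
        = {ereal (cost c 2 s) |s. chain T 2 s \<and> tip 2 s = z}" (is "?L = ?R")
    proof (intro subset_antisym subsetI)
      fix t assume "t \<in> ?L"
      then obtain x1 y2 where t: "t = ereal (c x1 y + c (x - x1) y2)" "x1 \<in> inv_op T y" "y2 \<in> T x"
        by blast
      let ?s = "\<lambda>i::nat. if i = 1 then (x1, y) else (x, y2)"
      have "t = ereal (cost c 2 ?s)" "chain T 2 ?s" "tip 2 ?s = z"
        using t by (auto simp: cost_def chain_def tip_def z inv_op_def graph_of_def)
      then show "t \<in> ?R" by blast
    next
      fix t assume "t \<in> ?R"
      then obtain s where s: "t = ereal (cost c 2 s)" "chain T 2 s" "tip 2 s = z"
        by blast
      then have "t = ereal (c (fst (s 1)) y + c (x - fst (s 1)) (snd (s 2)))"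
          "fst (s 1) \<in> inv_op T y" "snd (s 2) \<in> T x"
        by (auto simp: set cost_def chain_def tip_def z inv_op_def graph_of_def case_prod_beta)
      then show "t \<in> ?L" by blast
    qed
    then show ?thesis
      by (simp add: 2 P_fin_def z)
  next
    case 3
    let ?v = "\<lambda>xs ys. c (xs 1) y + (\<Sum>i=2..k-1. c (xs i - xs (i - 1)) (ys i)) + c (x - xs (k - 1)) (ys k)"
    have "{2..k} = insert k {2..k - 1}"
      using 3 by auto
    then have cost_last: "cost c k s = c (fst (s 1)) (snd (s 1))
        + (\<Sum>i=2..k-1. c (fst (s i) - fst (s (i - 1))) (snd (s i)))
        + c (fst (s k) - fst (s (k - 1))) (snd (s k))" for s
      using 3 by (simp add: cost_def)
    have "{ereal (?v xs ys) |xs ys.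
             xs 1 \<in> inv_op T y \<and> ys k \<in> T x \<and> (\<forall>i\<in>{2..k-1}. (xs i, ys i) \<in> graph_of T)}
        = {ereal (cost c k s) |s. chain T k s \<and> tip k s = z}" (is "?L = ?R")
    proof (intro subset_antisym subsetI)
      fix t assume "t \<in> ?L"
      then obtain xs ys where t: "t = ereal (?v xs ys)" "xs 1 \<in> inv_op T y" "ys k \<in> T x"
          "\<forall>i\<in>{2..k-1}. (xs i, ys i) \<in> graph_of T"
        by blast
      let ?s = "\<lambda>i. (if i = k then x else xs i, if i = 1 then y else ys i)"
      have "(\<Sum>i=2..k-1. c (fst (?s i) - fst (?s (i - 1))) (snd (?s i)))
          = (\<Sum>i=2..k-1. c (xs i - xs (i - 1)) (ys i))"
        by (intro sum.cong) auto
      then have "cost c k ?s = ?v xs ys"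
        unfolding cost_last using 3 by auto
      then have "t = ereal (cost c k ?s)"
        using t(1) by simp
      moreover have "chain T k ?s"
        unfolding chain_def
      proof
        fix i assume i: "i \<in> {1..k}"
        then consider "i = 1" | "i = k" | "i \<in> {2..k - 1}" by fastforce
        then show "?s i \<in> graph_of T"
          by cases (use 3 t in \<open>auto simp: inv_op_def graph_of_def\<close>)
      qed
      moreover have "tip k ?s = z"
        by (simp add: tip_def z)
      ultimately show "t \<in> ?R" by blast
    next
      fix t assume "t \<in> ?R"
      then obtain s where s: "t = ereal (cost c k s)" "chain T k s" "tip k s = z"
        by blast
      let ?xs = "\<lambda>i. fst (s i)" and ?ys = "\<lambda>i. snd (s i)"
      have ends: "?xs k = x" "?ys 1 = y"
        using s(3) by (auto simp: tip_def z)
      have "s 1 \<in> graph_of T" "s k \<in> graph_of T"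
        using s(2) 3 by (auto simp: chain_def)
      then have "?xs 1 \<in> inv_op T y" "?ys k \<in> T x"
        using ends by (auto simp: inv_op_def graph_of_def case_prod_beta)
      moreover have "\<forall>i\<in>{2..k-1}. (?xs i, ?ys i) \<in> graph_of T"
        using s(2) by (auto simp: chain_def)
      moreover have "t = ereal (?v ?xs ?ys)"
        using ends by (simp add: s(1) cost_last)
      ultimately show "t \<in> ?L"
        by (intro CollectI exI[of _ ?xs] exI[of _ ?ys] conjI)
    qed
    then show ?thesis
      using 3 by (simp add: P_fin_def z)
  qed
qed

lemma phi_le_iff:
  assumes "bilinear c"
  shows "phi c T N z \<le> t \<longleftrightarrow>
    (\<forall>k\<in>lengths N. \<forall>s. chain T k s \<longrightarrow> ereal (zdot c z (tip k s) - cost c k s) \<le> t)"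
  by (cases N) (auto simp: phi_def lengths_def phi_fin_eq[OF assms] Sup_le_iff SUP_le_iff)

lemma le_P_fun_iff:
  assumes "bilinear c" and "1 \<le> N"
  shows "t \<le> P_fun c T N z \<longleftrightarrow>
    (\<forall>k\<in>lengths N. \<forall>s. chain T k s \<longrightarrow> tip k s = z \<longrightarrow> t \<le> ereal (cost c k s))"
proof (cases N)
  case (enat k)
  with assms show ?thesis
    by (auto simp: P_fun_def lengths_def P_fin_eq le_Inf_iff one_enat_def)
next
  case infinity
  with assms show ?thesis
    by (auto simp: P_fun_def lengths_def P_fin_eq le_Inf_iff le_INF_iff)
qed

lemma phi_ge:
  assumes "bilinear c" and "k \<in> lengths N" and "chain T k s"
  shows "ereal (zdot c z (tip k s) - cost c k s) \<le> phi c T N z"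
  using phi_le_iff[OF assms(1), of T N z "phi c T N z"] assms(2,3) by blast

lemma P_fun_le:
  assumes "bilinear c" and "1 \<le> N" and "k \<in> lengths N" and "chain T k s"
  shows "P_fun c T N (tip k s) \<le> ereal (cost c k s)"
  using le_P_fun_iff[OF assms(1,2), of "P_fun c T N (tip k s)"] assms(3,4) by blast

lemma zdot_commute: "zdot c z w = zdot c w z"
  by (simp add: zdot_def add.commute)

section \<open>The three inequalities\<close>

lemma phi_le_P_iff:
  assumes "bilinear c" and "1 \<le> n" and "1 \<le> m"
  shows "phi c T n \<le> P_fun c T m \<longleftrightarrow> monotone_op c T (n + m)"
proof -
  have "phi c T n \<le> P_fun c T m \<longleftrightarrow>
    (\<forall>a\<in>lengths n. \<forall>b\<in>lengths m. \<forall>p q. chain T a p \<longrightarrow> chain T b q \<longrightarrow>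
       zdot c (tip b q) (tip a p) - cost c a p \<le> cost c b q)"
    unfolding le_fun_def phi_le_iff[OF assms(1)] le_P_fun_iff[OF assms(1,3)] ereal_less_eq by blast
  also have "\<dots> \<longleftrightarrow> monotone_op c T (n + m)"
    unfolding monotone_op_add_iff[OF assms]
    by (simp add: zdot_commute diff_le_eq add.commute)
  finally show ?thesis .
qed

text \<open>The Fenchel--Young inequality for \<open>\<phi>\<^sub>n\<close> as the conjugate of \<open>P\<^sub>n\<close>.\<close>

lemma psi_le_P:
  assumes "bilinear c" and "1 \<le> N"
  shows "psi c T N z \<le> P_fun c T N z"
  unfolding le_P_fun_iff[OF assms]
proof (intro ballI allI impI)
  fix k s assume k: "k \<in> lengths N" and s: "chain T k s" and z: "tip k s = z"
  show "psi c T N z \<le> ereal (cost c k s)"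
    unfolding psi_def conjugate_def
  proof (rule SUP_least)
    fix w
    have "ereal (zdot c w z - cost c k s) \<le> phi c T N w"
      using phi_ge[OF assms(1) k s, of w] z by simp
    then show "ereal (zdot c z w) - phi c T N w \<le> ereal (cost c k s)"
      by (cases "phi c T N w") (auto simp: zdot_commute[of c z w])
  qed
qed

text \<open>An affine functional below \<open>f\<close> keeps the epigraph of \<open>f\<close> in a half-space, which is convex and
  hence contains the convex hull as well; a conjugate is a supremum of such functionals.\<close>

lemma affine_le_conv_fun:
  assumes "bilinear c" and "\<And>z. ereal (zdot c z w + r) \<le> f z"
  shows "ereal (zdot c z w + r) \<le> conv_fun f z"
proof -
  let ?H = "{(z, t). zdot c z w + r \<le> t}"
  have "epi f \<subseteq> ?H"
    using assms(2) by (auto simp: epi_def) (metis ereal_less_eq(3) order_trans)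
  moreover have "convex ?H"
  proof (rule convexI)
    fix p q :: "('a \<times> 'b) \<times> real" and u v :: real
    assume p: "p \<in> ?H" and q: "q \<in> ?H" and uv: "0 \<le> u" "0 \<le> v" "u + v = 1"
    have "u * (zdot c (fst p) w + r) + v * (zdot c (fst q) w + r) \<le> u * snd p + v * snd q"
      using p q uv by (intro add_mono mult_left_mono) auto
    moreover have "u * r + v * r = r"
      using uv by (metis distrib_right mult_1)
    moreover have "zdot c (u *\<^sub>R fst p + v *\<^sub>R fst q) w = u * zdot c (fst p) w + v * zdot c (fst q) w"
      using assms(1)
      by (simp add: zdot_def bilinear_ladd bilinear_radd bilinear_lmul bilinear_rmul algebra_simps)
    ultimately show "u *\<^sub>R p + v *\<^sub>R q \<in> ?H"
      by (simp add: case_prod_beta algebra_simps)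
  qed
  ultimately have "convex hull (epi f) \<subseteq> ?H"
    by (rule hull_minimal)
  then show ?thesis
    by (auto simp: conv_fun_def intro!: Inf_greatest)
qed

lemma conjugate_le_conv_fun:
  assumes "bilinear c" and "conjugate c g \<le> f"
  shows "conjugate c g \<le> conv_fun f"
proof (rule le_funI)
  fix z
  show "conjugate c g z \<le> conv_fun f z"
    unfolding conjugate_def
  proof (rule SUP_least)
    fix w
    have le: "ereal (zdot c z' w) - g w \<le> f z'" for z'
      using assms(2) by (simp add: conjugate_def le_fun_def SUP_le_iff del: split_paired_All)
    show "ereal (zdot c z w) - g w \<le> conv_fun f z"
    proof (cases "g w")
      case (real r)
      then have "ereal (zdot c z' w + (- r)) \<le> f z'" for z'
        using le[of z'] by simp
      from affine_le_conv_fun[OF assms(1) this, of z] real show ?thesis by simp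
    next
      case MInf
      \<comment> \<open>Then \<open>f\<close> is constantly \<open>\<infinity>\<close>, so that its epigraph is empty.\<close>
      with le have "epi f = {}"
        by (auto simp: epi_def)
      then show ?thesis
        by (simp add: conv_fun_def top_ereal_def)
    qed simp
  qed
qed

lemma psi_le_conv_P:
  assumes "bilinear c" and "1 \<le> N"
  shows "psi c T N \<le> conv_fun (P_fun c T N)"
  using conjugate_le_conv_fun[OF assms(1), of "phi c T N"] psi_le_P[OF assms]
  unfolding psi_def by (simp add: le_fun_def)

lemma conv_fun_le: "conv_fun f \<le> f"
proof (rule le_funI)
  fix z
  show "conv_fun f z \<le> f z"
  proof (rule ereal_le_real)
    fix t assume "f z \<le> ereal t"
    then have "(z, t) \<in> convex hull (epi f)"
      by (intro hull_inc) (simp add: epi_def)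
    then show "conv_fun f z \<le> ereal t"
      unfolding conv_fun_def by (intro Inf_lower) blast
  qed
qed

text \<open>The roles of the orders are exchanged here: \<open>\<phi>\<^sub>n\<close> is the supremum of \<open>z \<cdot> w - P\<^sub>n(w)\<close>, and
  \<open>P\<^sub>n\<close> dominates \<open>\<phi>\<^sub>m\<close> by the symmetry of the monotonicity condition in \<open>n\<close> and \<open>m\<close>.\<close>

lemma phi_le_psi:
  assumes "bilinear c" and "1 \<le> n" and "1 \<le> m" and "monotone_op c T (n + m)"
  shows "phi c T n \<le> psi c T m"
proof (rule le_funI)
  fix z
  have le: "phi c T m \<le> P_fun c T n"
    using assms by (simp add: phi_le_P_iff add.commute)
  show "phi c T n z \<le> psi c T m z"
    unfolding phi_le_iff[OF assms(1)]
  proof (intro ballI allI impI)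
    fix k s assume k: "k \<in> lengths n" and s: "chain T k s"
    have "phi c T m (tip k s) \<le> ereal (cost c k s)"
      using le_funD[OF le] P_fun_le[OF assms(1,2) k s] by (rule order_trans)
    then have "ereal (zdot c z (tip k s) - cost c k s) \<le> ereal (zdot c z (tip k s)) - phi c T m (tip k s)"
      by (cases "phi c T m (tip k s)") auto
    also have "\<dots> \<le> psi c T m z"
      unfolding psi_def conjugate_def by (rule SUP_upper) simp
    finally show "ereal (zdot c z (tip k s) - cost c k s) \<le> psi c T m z" .
  qed
qed

section \<open>Values on the graph and properness\<close>

lemma cost_const:
  assumes "bilinear c"
  shows "cost c k (\<lambda>_. z) = c (fst z) (snd z)"
  using assms by (simp add: cost_def bilinear_lzero)

lemma coupling_le_phi:
  assumes "bilinear c" and "z \<in> graph_of T"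
  shows "coupling c z \<le> phi c T N z"
proof -
  obtain k where k: "k \<in> lengths N" using lengths_nonempty by blast
  have "ereal (zdot c z z - c (fst z) (snd z)) \<le> phi c T N z"
    using phi_ge[OF assms(1) k chain_const[OF assms(2)], of z] cost_const[OF assms(1)] by simp
  then show ?thesis
    by (simp add: zdot_def coupling_def case_prod_beta)
qed

lemma P_le_coupling:
  assumes "bilinear c" and "1 \<le> N" and "z \<in> graph_of T"
  shows "P_fun c T N z \<le> coupling c z"
proof -
  obtain k where k: "k \<in> lengths N" using lengths_nonempty by blast
  show ?thesis
    using P_fun_le[OF assms(1,2) k chain_const[OF assms(3)]] cost_const[OF assms(1)]
    by (simp add: coupling_def case_prod_beta)
qed

lemma phi_not_MInf:
  assumes "bilinear c" and "graph_of T \<noteq> {}"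
  shows "phi c T N z \<noteq> -\<infinity>"
proof -
  obtain w where w: "w \<in> graph_of T" using assms(2) by blast
  obtain k where k: "k \<in> lengths N" using lengths_nonempty by blast
  show ?thesis
    using phi_ge[OF assms(1) k chain_const[OF w], of z] by auto
qed

lemma proper_funI:
  assumes "f w = coupling c w" and "\<And>z. g z \<noteq> -\<infinity>" and "g \<le> f"
  shows "proper_fun f"
  unfolding proper_fun_def
proof (intro conjI exI allI)
  show "f w \<noteq> \<infinity>"
    using assms(1) by (simp add: coupling_def case_prod_beta)
  show "f z \<noteq> -\<infinity>" for z
    using assms(2)[of z] le_funD[OF assms(3), of z] by auto
qed

lemma graph_values_and_proper:
  assumes "bilinear c" and "1 \<le> k" and mono: "monotone_op c T (k + 1)"
  shows "graph_of T \<subseteq> eq_set (phi c T k) (coupling c) \<inter> eq_set (P_fun c T k) (coupling c) \<inter>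
      eq_set (conv_fun (P_fun c T k)) (coupling c) \<inter> eq_set (psi c T k) (coupling c)"
    and "graph_of T \<noteq> {} \<Longrightarrow> proper_fun (phi c T k) \<and> proper_fun (psi c T k) \<and>
      proper_fun (conv_fun (P_fun c T k)) \<and> proper_fun (P_fun c T k)"
proof -
  have phi_P1: "phi c T k \<le> P_fun c T 1"
    using phi_le_P_iff[OF assms(1,2), of 1] mono by simp
  have phi1_psi: "phi c T 1 \<le> psi c T k"
    using phi_le_psi[OF assms(1) _ assms(2), of 1] mono by (simp add: add.commute)
  have psi_conv: "psi c T k \<le> conv_fun (P_fun c T k)"
    by (rule psi_le_conv_P[OF assms(1,2)])
  have conv_P: "conv_fun (P_fun c T k) \<le> P_fun c T k"
    by (rule conv_fun_le)
  have eqs: "phi c T k z = coupling c z" "psi c T k z = coupling c z"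
    "conv_fun (P_fun c T k) z = coupling c z" "P_fun c T k z = coupling c z"
    if z: "z \<in> graph_of T" for z
  proof -
    note lower = coupling_le_phi[OF assms(1) z]
    have "phi c T k z \<le> coupling c z"
      using le_funD[OF phi_P1, of z] P_le_coupling[OF assms(1) _ z, of 1] by simp
    with lower[of k] show "phi c T k z = coupling c z" by simp
    have "coupling c z \<le> psi c T k z"
      using lower[of 1] le_funD[OF phi1_psi, of z] by simp
    moreover note le_funD[OF psi_conv, of z] le_funD[OF conv_P, of z] P_le_coupling[OF assms(1,2) z]
    ultimately show "psi c T k z = coupling c z"
      "conv_fun (P_fun c T k) z = coupling c z" "P_fun c T k z = coupling c z"
      by (auto intro: antisym order_trans)
  qed
  then show "graph_of T \<subseteq> eq_set (phi c T k) (coupling c) \<inter> eq_set (P_fun c T k) (coupling c) \<inter>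
      eq_set (conv_fun (P_fun c T k)) (coupling c) \<inter> eq_set (psi c T k) (coupling c)"
    by (auto simp: eq_set_def)
  assume ne: "graph_of T \<noteq> {}"
  then obtain w where w: "w \<in> graph_of T" by blast
  note finite_below = phi_not_MInf[OF assms(1) ne]
  have phi1_conv: "phi c T 1 \<le> conv_fun (P_fun c T k)"
    using phi1_psi psi_conv by (rule order_trans)
  have "proper_fun f" if "f w = coupling c w" "phi c T N \<le> f" for f N
    using proper_funI[of f w c "phi c T N"] that finite_below by blast
  then show "proper_fun (phi c T k) \<and> proper_fun (psi c T k) \<and>
      proper_fun (conv_fun (P_fun c T k)) \<and> proper_fun (P_fun c T k)"
    using eqs[OF w] phi1_psi phi1_conv order_trans[OF phi1_conv conv_P] order_refl by metis
qed

theorem theorem7: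
  fixes c :: "'x::real_vector \<Rightarrow> 'y::real_vector \<Rightarrow> real"
    and T :: "'x \<Rightarrow> 'y set"
    and n m :: enat
  assumes "bilinear c" and "1 \<le> n" and "1 \<le> m"
  shows "(monotone_op c T (n + m) \<longleftrightarrow> phi c T n \<le> P_fun c T m) \<and>
         (monotone_op c T (n + m) \<longleftrightarrow> phi c T n \<le> conv_fun (P_fun c T m)) \<and>
         (monotone_op c T (n + m) \<longleftrightarrow> phi c T n \<le> psi c T m) \<and>
         (monotone_op c T (n + m) \<longrightarrow>
           (\<forall>k::enat. 1 \<le> k \<and> k \<le> n + m - 1 \<longrightarrow>
             graph_of T \<subseteq> eq_set (phi c T k) (coupling c) \<inter> eq_set (P_fun c T k) (coupling c) \<inter>
                          eq_set (conv_fun (P_fun c T k)) (coupling c) \<inter> eq_set (psi c T k) (coupling c) \<and>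
             (graph_of T \<noteq> {} \<longrightarrow>
               proper_fun (phi c T k) \<and> proper_fun (psi c T k) \<and>
               proper_fun (conv_fun (P_fun c T k)) \<and> proper_fun (P_fun c T k))))"
proof -
  note phi_P = phi_le_P_iff[OF assms, of T]
  have psi_conv: "psi c T m \<le> conv_fun (P_fun c T m)"
    by (rule psi_le_conv_P[OF assms(1,3)])
  have conv_P: "conv_fun (P_fun c T m) \<le> P_fun c T m"
    by (rule conv_fun_le)
  note phi_psi = phi_le_psi[OF assms, of T]
  have order: "2 \<le> k + 1 \<and> k + 1 \<le> n + m" if "1 \<le> k" "k \<le> n + m - 1" for k :: enat
    using that assms(2,3)
    by (cases k; cases n; cases m) (auto simp: one_enat_def numeral_eq_enat)
  have last: "graph_of T \<subseteq> eq_set (phi c T k) (coupling c) \<inter> eq_set (P_fun c T k) (coupling c) \<inter>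
        eq_set (conv_fun (P_fun c T k)) (coupling c) \<inter> eq_set (psi c T k) (coupling c) \<and>
      (graph_of T \<noteq> {} \<longrightarrow> proper_fun (phi c T k) \<and> proper_fun (psi c T k) \<and>
        proper_fun (conv_fun (P_fun c T k)) \<and> proper_fun (P_fun c T k))"
    if "monotone_op c T (n + m)" "1 \<le> k" "k \<le> n + m - 1" for k
  proof -
    have "monotone_op c T (k + 1)"
      using monotone_op_antimono[OF assms(1)] order[OF that(2,3)] that(1) by blast
    from graph_values_and_proper[OF assms(1) that(2) this] show ?thesis by blast
  qed
  show ?thesis
  proof (intro conjI)
    show "monotone_op c T (n + m) \<longleftrightarrow> phi c T n \<le> P_fun c T m"
      using phi_P by simp
    show "monotone_op c T (n + m) \<longleftrightarrow> phi c T n \<le> conv_fun (P_fun c T m)"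
      using phi_P phi_psi psi_conv conv_P by (meson order_trans)
    show "monotone_op c T (n + m) \<longleftrightarrow> phi c T n \<le> psi c T m"
      using phi_P phi_psi psi_conv conv_P by (meson order_trans)
  qed (use last in blast)
qed

end
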